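(* Let the meshes, the number $N\ge1$ of interior time steps, and the nonnegative discrete densities $\boldsymbol{\rho}^{in},\boldsymbol{\rho}^f\in\mathbb{P}_{\mathcal{T}'}$ with the same (positive) total discrete mass be fixed. For $\mu>0$ let $(\boldsymbol{\rho}^\mu,\boldsymbol{F}^\mu)$ be the solution of the perturbed problem $$\inf_{(\boldsymbol{\rho},\boldsymbol{F})\in\mathcal{C}_{N,\mathcal{T}}}\mathcal{B}_{N,\mathcal{T}}(\boldsymbol{\rho},\boldsymbol{F})+\mu\,\mathcal{J}_{N,\mathcal{T}}(\boldsymbol{\rho}).$$ Then, as $\mu\to0$, $(\boldsymbol{\rho}^\mu,\boldsymbol{F}^\mu)$ converges up to extraction of a subsequence to a solution $(\boldsymbol{\rho},\boldsymbol{F})$ of the unperturbed problem $$\inf_{(\boldsymbol{\rho},\boldsymbol{F})\in\mathcal{C}_{N,\mathcal{T}}}\mathcal{B}_{N,\mathcal{T}}(\boldsymbol{\rho},\boldsymbol{F});$$ that is, for every sequence $\mu_n>0$ with $\mu_n\to0$, some subsequence of $(\boldsymbol{\rho}^{\mu_n},\boldsymbol{F}^{\mu_n})$ converges to a minimizer of the unperturbed problem.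
   Context: **Meshes.** $\Omega\subset\mathbb{R}^d$ is convex and compact, polygonal if $d=2$, polyhedral if $d=3$. An admissible mesh $(\mathcal{T},\overline\Sigma,(\mathbf{x}_K)_{K\in\mathcal{T}})$ consists of a finite set $\mathcal{T}$ of disjoint open convex polytopal cells whose closures cover $\Omega$, the set $\overline\Sigma$ of their planar faces, and cell centers $\mathbf{x}_K\in\Omega$. Each face is either contained in $\partial\Omega$ or is an internal face $\sigma=K|L$ shared by exactly two cells; $\Sigma$ is the set of internal faces, $\Sigma_K$ those contained in $\partial K$. For $\sigma=K|L$, $\mathbf{x}_L\ne\mathbf{x}_K$ and $\mathbf{x}_L-\mathbf{x}_K$ is orthogonal to $\sigma$ with the same orientation as the normal to $\sigma$ outward with respect to $K$. $m_K$, $m_\sigma$ are the Lebesgue measures and $d_\sigma=|\mathbf{x}_K-\mathbf{x}_L|$. Two admissible meshes are given, a coarse one $\mathcal{T}'$ (cells $K'$) and a fine one $\mathcal{T}$ (cells $K$, faces $\Sigma$), such that every $K\in\mathcal{T}$ satisfies $\overline K\subseteq\overline{K'}$ for some $K'\in\mathcal{T}'$ (the two may coincide). **Discrete spaces and operators.** $\mathbb{P}_{\mathcal{T}}=\mathbb{R}^{\mathcal{T}}$, $\mathbb{P}_{\mathcal{T}'}=\mathbb{R}^{\mathcal{T}'}$, $\mathbb{P}_\Sigma=\mathbb{R}^\Sigma$. $\mathcal{I}:\mathbb{P}_{\mathcal{T}'}\to\mathbb{P}_{\mathcal{T}}$, $(\mathcal{I}\rho)_K=\rho_{K'}$ for $K\subset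 K'$. $\mathbb{F}_{\mathcal{T}}=\{(F_{K,\sigma},F_{L,\sigma})_{\sigma=K|L\in\Sigma}:F_{K,\sigma}+F_{L,\sigma}=0\}$, $F_\sigma=|F_{K,\sigma}|=|F_{L,\sigma}|$, $(\mathrm{div}_{\mathcal{T}}\boldsymbol{F})_K=\frac1{m_K}\sum_{\sigma\in\Sigma_K}F_{K,\sigma}m_\sigma$. $\mathcal{R}_\Sigma:\mathbb{P}_{\mathcal{T}}\to\mathbb{P}_\Sigma$ is a reconstruction operator that (on nonnegative arguments) is component-wise concave, positively 1-homogeneous and positivity preserving (it maps nonnegative vectors to nonnegative vectors and positive vectors to positive vectors); the functional $\mathcal{B}_{N,\mathcal{T}}$ below is convex and lower semicontinuous. **Problems.** $\tau=\frac1{N+1}$. $B(p,Q)=\frac{|Q|^2}{2p}$ if $p>0$, $B(0,0)=0$, $B=+\infty$ otherwise. For $\boldsymbol{\rho}=(\boldsymbol{\rho}^k)_{k=0}^{N+1}\in[\mathbb{P}_{\mathcal{T}'}]^{N+2}$ and $\boldsymbol{F}=(\boldsymbol{F}^k)_{k=1}^{N+1}\in[\mathbb{F}_{\mathcal{T}}]^{N+1}$, $$\mathcal{B}_{N,\mathcal{T}}(\boldsymbol{\rho},\boldsymbol{F})=\sum_{k=1}^{N+1}\tau\sum_{\sigma\in\Sigma}B\Big(\big(\mathcal{R}_\Sigma(\mathcal{I}\tfrac{\boldsymbol{\rho}^k+\boldsymbol{\rho}^{k-1}}2)\big)_\sigma,F^k_\sigma\Big)m_\sigma d_\sigma$$ if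 all $\rho^k_{K'}\ge0$, and $+\infty$ otherwise. The total discrete mass of $\boldsymbol{a}\in\mathbb{P}_{\mathcal{T}'}$ is $\sum_{K'}a_{K'}m_{K'}$. $\mathcal{C}_{N,\mathcal{T}}$ is the set of $(\boldsymbol{\rho},\boldsymbol{F})$ with $\mathcal{I}\big(\frac{\boldsymbol{\rho}^k-\boldsymbol{\rho}^{k-1}}\tau\big)+\mathrm{div}_{\mathcal{T}}\boldsymbol{F}^k=0$ for $k=1,\dots,N+1$, $\boldsymbol{\rho}^0=\boldsymbol{\rho}^{in}$, $\boldsymbol{\rho}^{N+1}=\boldsymbol{\rho}^f$. The barrier is $\mathcal{J}_{N,\mathcal{T}}(\boldsymbol{\rho})=\sum_{k=1}^N\tau\sum_{K'\in\mathcal{T}'}J(\rho^k_{K'})m_{K'}$ with $J(x)=-\log x$ for $x>0$ and $J(x)=+\infty$ for $x\le0$. For each $\mu>0$ the perturbed problem has a unique solution. *)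

theory Defs
  imports "HOL-Analysis.Analysis"
begin

record 'a mesh =
  cells :: "'a set set"
  faces :: "'a set set"
  center :: "'a set \<Rightarrow> 'a"

text \<open>The \<open>(d-1)\<close>-dimensional Lebesgue measure of a set \<open>\<sigma>\<close> that lies in some hyperplane
  \<open>z + span B\<close>: the product Lebesgue measure of \<open>\<sigma>\<close> in the Cartesian coordinates given by an
  orthonormal basis \<open>B\<close> of the direction of the hyperplane. The value does not depend on \<open>B\<close>.
  It is used only for compact subsets of hyperplanes.\<close>

definition orthonormal_frame :: "'a::euclidean_space set \<Rightarrow> 'a set \<Rightarrow> bool" where
  "orthonormal_frame \<sigma> B \<longleftrightarrow>
     pairwise orthogonal B \<and> (\<forall>b\<in>B. norm b = 1) \<and> finite B \<and> card B = DIM('a) - 1 \<and>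
     (\<exists>z. \<forall>x\<in>\<sigma>. x - z \<in> span B)"

definition face_measure :: "'a::euclidean_space set \<Rightarrow> real" where
  "face_measure \<sigma> =
     (let B = (SOME B. orthonormal_frame \<sigma> B)
      in measure (PiM B (\<lambda>_. lborel)) ((\<lambda>x. \<lambda>b\<in>B. x \<bullet> b) ` \<sigma>))"

definition cell_measure :: "'a::euclidean_space set \<Rightarrow> real" where
  "cell_measure K = measure lebesgue K"

text \<open>\<open>between M \<sigma> K L\<close> is the relation \<open>\<sigma> = K|L\<close>: the face \<open>\<sigma>\<close> is shared by exactly the two
  distinct cells \<open>K\<close> and \<open>L\<close>.\<close>

definition between :: "'a::euclidean_space mesh \<Rightarrow> 'a set \<Rightarrow> 'a set \<Rightarrow> 'a set \<Rightarrow> bool" where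
  "between M \<sigma> K L \<longleftrightarrow>
     \<sigma> \<in> faces M \<and> K \<noteq> L \<and> {J \<in> cells M. \<sigma> \<subseteq> frontier J} = {K, L}"

definition internal_faces :: "'a::euclidean_space mesh \<Rightarrow> 'a set set" where
  "internal_faces M = {\<sigma> \<in> faces M. \<exists>K L. between M \<sigma> K L}"

definition internal_faces_of :: "'a::euclidean_space mesh \<Rightarrow> 'a set \<Rightarrow> 'a set set" where
  "internal_faces_of M K = {\<sigma> \<in> internal_faces M. \<sigma> \<subseteq> frontier K}"

text \<open>The last conjunct says that \<open>x\<^sub>L - x\<^sub>K\<close> is nonzero, orthogonal to \<open>\<sigma> = K|L\<close>, and points to
  the side of \<open>\<sigma>\<close> opposite to \<open>K\<close>, i.e. has the direction of the normal outward with respect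
  to \<open>K\<close>. Faces may be proper parts of the facets of a cell (nonconforming meshes are allowed),
  but two cells share at most one face, and that face is all of their common boundary.\<close>

definition admissible_mesh :: "'a::euclidean_space set \<Rightarrow> 'a mesh \<Rightarrow> bool" where
  "admissible_mesh \<Omega> M \<longleftrightarrow>
     finite (cells M) \<and>
     (\<forall>K\<in>cells M. K \<noteq> {} \<and> open K \<and> convex K \<and> polytope (closure K)) \<and>
     pairwise disjnt (cells M) \<and>
     (\<Union>K\<in>cells M. closure K) = \<Omega> \<and>
     finite (faces M) \<and>
     (\<forall>\<sigma>\<in>faces M. polytope \<sigma> \<and> (\<exists>a b. a \<noteq> 0 \<and> \<sigma> \<subseteq> {x. a \<bullet> x = b}) \<and> 0 < face_measure \<sigma>) \<and>
     (\<forall>\<sigma>\<in>faces M. \<forall>\<sigma>'\<in>faces M. \<sigma> \<noteq> \<sigma>' \<longrightarrow> face_measure (\<sigma> \<inter> \<sigma>') = 0) \<and>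
     (\<forall>\<sigma>\<in>faces M. \<exists>K\<in>cells M. \<sigma> \<subseteq> frontier K) \<and>
     (\<forall>K\<in>cells M. frontier K = \<Union>{\<sigma> \<in> faces M. \<sigma> \<subseteq> frontier K}) \<and>
     (\<forall>\<sigma>\<in>faces M. \<sigma> \<subseteq> frontier \<Omega> \<or> (\<exists>K L. between M \<sigma> K L)) \<and>
     (\<forall>K\<in>cells M. \<forall>L\<in>cells M. K \<noteq> L \<longrightarrow>
        closure K \<inter> closure L \<in> faces M \<or> face_measure (closure K \<inter> closure L) = 0) \<and>
     (\<forall>\<sigma> K L. between M \<sigma> K L \<longrightarrow> \<sigma> = closure K \<inter> closure L) \<and>
     (\<forall>K\<in>cells M. center M K \<in> \<Omega>) \<and>
     (\<forall>\<sigma> K L. between M \<sigma> K L \<longrightarrow>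
        center M L \<noteq> center M K \<and>
        (\<forall>y\<in>\<sigma>. \<forall>z\<in>\<sigma>. (center M L - center M K) \<bullet> (y - z) = 0) \<and>
        (\<forall>y\<in>\<sigma>. \<forall>z\<in>K. (center M L - center M K) \<bullet> (y - z) > 0))"

text \<open>The first mesh is the coarse one.\<close>

definition mesh_refines :: "'a::euclidean_space mesh \<Rightarrow> 'a mesh \<Rightarrow> bool" where
  "mesh_refines M' M \<longleftrightarrow> (\<forall>K\<in>cells M. \<exists>K'\<in>cells M'. closure K \<subseteq> closure K')"

definition face_dist :: "'a::euclidean_space mesh \<Rightarrow> 'a set \<Rightarrow> real" where
  "face_dist M \<sigma> = (THE r. \<exists>K L. between M \<sigma> K L \<and> r = dist (center M K) (center M L))"

text \<open>\<open>\<real>\<^sup>I\<close> for a finite set \<open>I\<close> is represented by the functions vanishing off \<open>I\<close>. Vectors are thus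
  determined by their components on \<open>I\<close>, and convergence in the product topology of the function
  type is convergence of these components.\<close>

definition vectors :: "'i set \<Rightarrow> ('i \<Rightarrow> real) set" where
  "vectors I = {a. \<forall>i. i \<notin> I \<longrightarrow> a i = 0}"

definition fluxes :: "'a::euclidean_space mesh \<Rightarrow> ('a set \<Rightarrow> 'a set \<Rightarrow> real) set" where
  "fluxes M =
     {F. (\<forall>\<sigma> K L. between M \<sigma> K L \<longrightarrow> F K \<sigma> + F L \<sigma> = 0) \<and>
         (\<forall>K \<sigma>. \<not> (K \<in> cells M \<and> \<sigma> \<in> internal_faces_of M K) \<longrightarrow> F K \<sigma> = 0)}"

definition flux_abs :: "'a::euclidean_space mesh \<Rightarrow> ('a set \<Rightarrow> 'a set \<Rightarrow> real) \<Rightarrow> 'a set \<Rightarrow> real" where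
  "flux_abs M F \<sigma> = (THE q. \<exists>K L. between M \<sigma> K L \<and> q = \<bar>F K \<sigma>\<bar>)"

definition discrete_div ::
  "'a::euclidean_space mesh \<Rightarrow> ('a set \<Rightarrow> 'a set \<Rightarrow> real) \<Rightarrow> 'a set \<Rightarrow> real" where
  "discrete_div M F K =
     1 / cell_measure K * (\<Sum>\<sigma>\<in>internal_faces_of M K. F K \<sigma> * face_measure \<sigma>)"

definition inject ::
  "'a::euclidean_space mesh \<Rightarrow> 'a mesh \<Rightarrow> ('a set \<Rightarrow> real) \<Rightarrow> 'a set \<Rightarrow> real" where
  "inject M' M a = (\<lambda>K. if K \<in> cells M then a (THE K'. K' \<in> cells M' \<and> K \<subseteq> K') else 0)"

definition reconstruction ::
  "'a::euclidean_space mesh \<Rightarrow> (('a set \<Rightarrow> real) \<Rightarrow> 'a set \<Rightarrow> real) \<Rightarrow> bool" where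
  "reconstruction M R \<longleftrightarrow>
     (let nonneg = {a \<in> vectors (cells M). \<forall>K\<in>cells M. 0 \<le> a K} in
       (\<forall>a\<in>vectors (cells M). R a \<in> vectors (internal_faces M)) \<and>
       (\<forall>a\<in>nonneg. \<forall>b\<in>nonneg. \<forall>t\<in>{0..1}. \<forall>\<sigma>\<in>internal_faces M.
          (1 - t) * R a \<sigma> + t * R b \<sigma> \<le> R (\<lambda>K. (1 - t) * a K + t * b K) \<sigma>) \<and>
       (\<forall>a\<in>nonneg. \<forall>c>0. \<forall>\<sigma>\<in>internal_faces M. R (\<lambda>K. c * a K) \<sigma> = c * R a \<sigma>) \<and>
       (\<forall>a\<in>nonneg. \<forall>\<sigma>\<in>internal_faces M. 0 \<le> R a \<sigma>) \<and>
       (\<forall>a\<in>nonneg. (\<forall>K\<in>cells M. 0 < a K) \<longrightarrow> (\<forall>\<sigma>\<in>internal_faces M. 0 < R a \<sigma>)))"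

definition total_mass :: "'a::euclidean_space mesh \<Rightarrow> ('a set \<Rightarrow> real) \<Rightarrow> real" where
  "total_mass M a = (\<Sum>K\<in>cells M. a K * cell_measure K)"

text \<open>A pair of a density trajectory and a flux trajectory; the index of type \<open>nat\<close> is the time
  step.\<close>

type_synonym 'a trajectory =
  "(nat \<Rightarrow> 'a set \<Rightarrow> real) \<times> (nat \<Rightarrow> 'a set \<Rightarrow> 'a set \<Rightarrow> real)"

text \<open>Densities carry the indices \<open>0, \<dots>, N+1\<close> and fluxes the indices \<open>1, \<dots>, N+1\<close>; as above,
  everything is zero outside the index range.\<close>

definition trajectories ::
  "nat \<Rightarrow> 'a::euclidean_space mesh \<Rightarrow> 'a mesh \<Rightarrow> 'a trajectory set" where
  "trajectories N M' M =
     {(\<rho>, F). (\<forall>k\<in>{0..N+1}. \<rho> k \<in> vectors (cells M')) \<and> (\<forall>k. k \<notin> {0..N+1} \<longrightarrow> \<rho> k = (\<lambda>_. 0)) \<and>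
              (\<forall>k\<in>{1..N+1}. F k \<in> fluxes M) \<and> (\<forall>k. k \<notin> {1..N+1} \<longrightarrow> F k = (\<lambda>_ _. 0))}"

definition time_step :: "nat \<Rightarrow> real" where
  "time_step N = 1 / (real N + 1)"

definition kinetic :: "real \<Rightarrow> real \<Rightarrow> ereal" where
  "kinetic p Q =
     (if p > 0 then ereal (\<bar>Q\<bar>\<^sup>2 / (2 * p)) else if p = 0 \<and> Q = 0 then 0 else \<infinity>)"

definition action ::
  "nat \<Rightarrow> 'a::euclidean_space mesh \<Rightarrow> 'a mesh \<Rightarrow> (('a set \<Rightarrow> real) \<Rightarrow> 'a set \<Rightarrow> real)
     \<Rightarrow> 'a trajectory \<Rightarrow> ereal" where
  "action N M' M R = (\<lambda>(\<rho>, F).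
     if \<forall>k\<in>{0..N+1}. \<forall>K\<in>cells M'. 0 \<le> \<rho> k K
     then \<Sum>k=1..N+1. ereal (time_step N) * (\<Sum>\<sigma>\<in>internal_faces M.
            kinetic (R (inject M' M (\<lambda>K. (\<rho> k K + \<rho> (k - 1) K) / 2)) \<sigma>) (flux_abs M (F k) \<sigma>)
            * ereal (face_measure \<sigma> * face_dist M \<sigma>))
     else \<infinity>)"

definition log_barrier :: "real \<Rightarrow> ereal" where
  "log_barrier x = (if x > 0 then ereal (- ln x) else \<infinity>)"

definition barrier :: "nat \<Rightarrow> 'a::euclidean_space mesh \<Rightarrow> (nat \<Rightarrow> 'a set \<Rightarrow> real) \<Rightarrow> ereal" where
  "barrier N M' \<rho> =
     (\<Sum>k=1..N. ereal (time_step N) *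
        (\<Sum>K\<in>cells M'. log_barrier (\<rho> k K) * ereal (cell_measure K)))"

definition perturbed_action ::
  "nat \<Rightarrow> 'a::euclidean_space mesh \<Rightarrow> 'a mesh \<Rightarrow> (('a set \<Rightarrow> real) \<Rightarrow> 'a set \<Rightarrow> real)
     \<Rightarrow> real \<Rightarrow> 'a trajectory \<Rightarrow> ereal" where
  "perturbed_action N M' M R \<mu> = (\<lambda>(\<rho>, F). action N M' M R (\<rho>, F) + ereal \<mu> * barrier N M' \<rho>)"

definition constraint_set ::
  "nat \<Rightarrow> 'a::euclidean_space mesh \<Rightarrow> 'a mesh \<Rightarrow> ('a set \<Rightarrow> real) \<Rightarrow> ('a set \<Rightarrow> real)
     \<Rightarrow> 'a trajectory set" where
  "constraint_set N M' M \<rho>in \<rho>f =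
     {(\<rho>, F) \<in> trajectories N M' M.
        (\<forall>k\<in>{1..N+1}. \<forall>K\<in>cells M.
           inject M' M (\<lambda>K'. (\<rho> k K' - \<rho> (k - 1) K') / time_step N) K
           + discrete_div M (F k) K = 0) \<and>
        \<rho> 0 = \<rho>in \<and> \<rho> (N + 1) = \<rho>f}"

definition convex_functional_on ::
  "'a trajectory set \<Rightarrow> ('a trajectory \<Rightarrow> ereal) \<Rightarrow> bool" where
  "convex_functional_on S f \<longleftrightarrow>
     (\<forall>(\<rho>, F)\<in>S. \<forall>(\<rho>', F')\<in>S. \<forall>t\<in>{0..1}.
        f (\<lambda>k K. (1 - t) * \<rho> k K + t * \<rho>' k K, \<lambda>k K \<sigma>. (1 - t) * F k K \<sigma> + t * F' k K \<sigma>)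
        \<le> ereal (1 - t) * f (\<rho>, F) + ereal t * f (\<rho>', F'))"

definition lower_semicontinuous_on ::
  "'b::topological_space set \<Rightarrow> ('b \<Rightarrow> ereal) \<Rightarrow> bool" where
  "lower_semicontinuous_on S f \<longleftrightarrow> (\<forall>x\<in>S. \<forall>c<f x. \<forall>\<^sub>F y in at x within S. c < f y)"

end

theory Submission
  imports Defs
begin

text \<open>
  The proof is a compactness argument followed by a comparison argument.

  The reference point is the minimizer \<open>q\<close> for \<open>\<mu> = 1\<close>. If its perturbed energy is infinite, then
  every element of the constraint set is a minimizer, so uniqueness makes the constraint set a
  singleton and there is nothing to prove. Otherwise \<open>q\<close> has finite action and positive interior
  densities.

  The discrete divergence has zero mean, hence the mass of the densities is conserved in time
  and nonnegative densities in the constraint set are uniformly bounded (\<open>density_bound\<close>). So the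
  barrier is bounded below along the minimizers, and comparison with \<open>q\<close> bounds their actions
  (\<open>perturbed_minimizer_action_le\<close>). The reconstruction is concave, positively homogeneous and
  nonnegative, hence monotone (\<open>reconstruction_mono\<close>), so that bounded densities have bounded
  reconstructions and a bounded action bounds the fluxes (\<open>flux_bound\<close>). A subsequence therefore
  converges, and its limit satisfies the constraints, which are closed.

  If some \<open>y\<close> in the constraint set had a smaller action than the limit, so would a point
  \<open>(1 - t) y + t q\<close> for small \<open>t > 0\<close>, by convexity. Its interior densities are positive, so its
  barrier is finite, and minimality for \<open>\<mu>\<close> bounds the action of the minimizers by the action of
  this point up to a multiple of \<open>\<mu>\<close>. As \<open>\<mu>\<close> tends to \<open>0\<close> this contradicts lower semicontinuity
  (\<open>perturbed_minimizers_limit_minimal\<close>).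
\<close>

section \<open>Sequences of functions with finite support\<close>

lemma tendsto_fun_iff:
  fixes f :: "'b \<Rightarrow> 'i \<Rightarrow> 'c::topological_space"
  shows "(f \<longlongrightarrow> l) F \<longleftrightarrow> (\<forall>i. ((\<lambda>n. f n i) \<longlongrightarrow> l i) F)"
proof -
  have "(f \<longlongrightarrow> l) F \<longleftrightarrow> limitin (product_topology (\<lambda>_. euclidean) UNIV) f l F"
    by (simp add: euclidean_product_topology)
  also have "\<dots> \<longleftrightarrow> (\<forall>i. ((\<lambda>n. f n i) \<longlongrightarrow> l i) F)"
    by (simp add: limitin_componentwise)
  finally show ?thesis .
qed

lemma finite_family_convergent_subsequence:
  fixes x :: "nat \<Rightarrow> 'i \<Rightarrow> real"
  assumes "finite I" and "\<And>i. i \<in> I \<Longrightarrow> \<exists>B. \<forall>n. \<bar>x n i\<bar> \<le> B"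
  shows "\<exists>r. strict_mono (r :: nat \<Rightarrow> nat) \<and> (\<forall>i\<in>I. convergent (\<lambda>n. x (r n) i))"
  using assms
proof (induction I rule: finite_induct)
  case empty
  show ?case using strict_mono_id by blast
next
  case (insert j I)
  then obtain r where r: "strict_mono (r :: nat \<Rightarrow> nat)" "\<forall>i\<in>I. convergent (\<lambda>n. x (r n) i)"
    by (metis insertI2)
  obtain B where "\<forall>n. \<bar>x n j\<bar> \<le> B"
    using insert.prems by blast
  then have "bounded (range (\<lambda>n. x (r n) j))"
    by (auto simp: bounded_iff)
  then obtain l s where s: "strict_mono (s :: nat \<Rightarrow> nat)" "((\<lambda>n. x (r n) j) \<circ> s) \<longlonglongrightarrow> l"
    using bounded_imp_convergent_subsequence by blast
  have "convergent (\<lambda>n. x ((r \<circ> s) n) i)" if "i \<in> insert j I" for i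
  proof (cases "i = j")
    case True
    then show ?thesis using s by (auto simp: convergent_def o_def)
  next
    case False
    then have "convergent ((\<lambda>n. x (r n) i) \<circ> s)"
      using that r s by (intro convergent_subseq_convergent) auto
    then show ?thesis by (simp add: o_def)
  qed
  moreover have "strict_mono (r \<circ> s)"
    using r s by (intro strict_mono_o)
  ultimately show ?case by blast
qed

lemma finite_support_convergent_subsequence:
  fixes x :: "nat \<Rightarrow> 'i \<Rightarrow> real"
  assumes "finite I" and "\<And>i. i \<in> I \<Longrightarrow> \<exists>B. \<forall>n. \<bar>x n i\<bar> \<le> B"
    and "\<And>n i. i \<notin> I \<Longrightarrow> x n i = 0"
  obtains r l where "strict_mono (r :: nat \<Rightarrow> nat)" "\<And>i. (\<lambda>n. x (r n) i) \<longlonglongrightarrow> l i"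
proof -
  obtain r where r: "strict_mono (r :: nat \<Rightarrow> nat)" "\<forall>i\<in>I. convergent (\<lambda>n. x (r n) i)"
    using finite_family_convergent_subsequence[of I x] assms(1,2) by blast
  have "convergent (\<lambda>n. x (r n) i)" for i
    using r assms(3)[of i] by (cases "i \<in> I") (auto simp: convergent_const)
  then have "(\<lambda>n. x (r n) i) \<longlonglongrightarrow> lim (\<lambda>n. x (r n) i)" for i
    by (simp add: convergent_LIMSEQ_iff)
  with r(1) show ?thesis by (rule that)
qed

section \<open>Nested admissible meshes\<close>

text \<open>A coarse mesh \<open>M'\<close> and a fine mesh \<open>M\<close> of the same domain.\<close>

locale nested_meshes =
  fixes \<Omega> :: "'a::euclidean_space set" and M' M :: "'a mesh"
  assumes coarse: "admissible_mesh \<Omega> M'" and fine: "admissible_mesh \<Omega> M"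
    and refines: "mesh_refines M' M"
begin

lemma finite_meshes [simp]:
  "finite (cells M')" "finite (cells M)" "finite (faces M)" "finite (internal_faces M)"
  using coarse fine by (auto simp: admissible_mesh_def internal_faces_def)

lemma cell_measure_pos:
  assumes "admissible_mesh \<Omega> m" and "K \<in> cells m"
  shows "0 < cell_measure K"
proof -
  have K: "K \<noteq> {}" "open K" "polytope (closure K)"
    using assms by (auto simp: admissible_mesh_def)
  then have "bounded K"
    by (meson bounded_subset closure_subset polytope_imp_bounded)
  then have "K \<in> lmeasurable"
    using K by (simp add: lmeasurable_open)
  moreover have "\<not> negligible K"
    using K open_not_negligible by blast
  ultimately show ?thesis
    unfolding cell_measure_def by (simp add: negligible_iff_measure0 zero_less_measure_iff)
qed

lemmas fine_cell_measure_pos = cell_measure_pos[OF fine]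
lemmas coarse_cell_measure_pos = cell_measure_pos[OF coarse]

text \<open>Closures of fine cells lie in closures of coarse cells; since a convex open set is the
  interior of its closure, the inclusion holds for the open cells themselves. So the description
  of the coarse cell in \<^const>\<open>inject\<close> is proper.\<close>

lemma fine_cell_in_coarse_cell:
  assumes "K \<in> cells M"
  shows "\<exists>!K'. K' \<in> cells M' \<and> K \<subseteq> K'"
proof -
  obtain K' where K': "K' \<in> cells M'" "closure K \<subseteq> closure K'"
    using refines assms by (auto simp: mesh_refines_def)
  have "open K" "K \<noteq> {}" using fine assms by (auto simp: admissible_mesh_def)
  have "open K'" "convex K'" using coarse K' by (auto simp: admissible_mesh_def)
  have "K \<subseteq> interior (closure K')"
    using K' \<open>open K\<close> by (meson closure_subset dual_order.trans interior_maximal)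
  then have "K \<subseteq> K'"
    using convex_interior_closure[OF \<open>convex K'\<close>] \<open>open K'\<close> by (simp add: interior_open)
  moreover have "L = K'" if "L \<in> cells M'" "K \<subseteq> L" for L
  proof (rule ccontr)
    assume "L \<noteq> K'"
    then have "disjnt L K'"
      using coarse K' that by (auto simp: admissible_mesh_def pairwise_def)
    then show False using \<open>K \<noteq> {}\<close> \<open>K \<subseteq> K'\<close> that by (auto simp: disjnt_def)
  qed
  ultimately show ?thesis using K' by blast
qed

lemma inject_eq:
  assumes "K \<in> cells M" "K' \<in> cells M'" "K \<subseteq> K'"
  shows "inject M' M a K = a K'"
proof -
  have "(THE L. L \<in> cells M' \<and> K \<subseteq> L) = K'"
    using fine_cell_in_coarse_cell[OF assms(1)] assms by (intro the1_equality) auto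
  then show ?thesis using assms by (simp add: inject_def)
qed

lemma inject_obtain:
  assumes "K \<in> cells M"
  obtains K' where "K' \<in> cells M'" "\<And>a. inject M' M a K = a K'"
  using fine_cell_in_coarse_cell[OF assms] inject_eq[OF assms] by metis

text \<open>Every value of a coarse vector is also a value of its injection into the fine mesh, so
  that bounds on the fine mesh give bounds on the coarse one.\<close>

lemma coarse_cell_contains_fine_cell:
  assumes "K' \<in> cells M'"
  obtains K where "K \<in> cells M" "\<And>a. inject M' M a K = a K'"
proof -
  have K': "open K'" "K' \<noteq> {}" "K' \<subseteq> \<Omega>"
    using coarse assms closure_subset by (auto simp: admissible_mesh_def)
  then obtain x where "x \<in> K'" "x \<in> \<Omega>" by blast
  then obtain K where K: "K \<in> cells M" "x \<in> closure K"
    using fine by (auto simp: admissible_mesh_def)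
  \<comment> \<open>an open set meeting a closure meets the set itself\<close>
  then have "K' \<inter> K \<noteq> {}"
    using K' \<open>x \<in> K'\<close> open_Int_closure_eq_empty[of K' K] by blast
  obtain L where L: "L \<in> cells M'" "K \<subseteq> L"
    using fine_cell_in_coarse_cell[OF K(1)] by blast
  have "L = K'"
  proof (rule ccontr)
    assume "L \<noteq> K'"
    then have "disjnt L K'"
      using coarse L assms by (auto simp: admissible_mesh_def pairwise_def)
    then show False using \<open>K' \<inter> K \<noteq> {}\<close> L by (auto simp: disjnt_def)
  qed
  then show ?thesis using that K(1) inject_eq[OF K(1) assms] L by blast
qed

lemma inject_vectors: "inject M' M a \<in> vectors (cells M)"
  by (simp add: inject_def vectors_def)

lemma internal_face_obtain:
  assumes "\<sigma> \<in> internal_faces M"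
  obtains K L where "between M \<sigma> K L"
  using assms by (auto simp: internal_faces_def)

lemma between_cells:
  assumes "between M \<sigma> K L"
  shows "K \<in> cells M" "L \<in> cells M" "K \<noteq> L" "{J \<in> cells M. \<sigma> \<subseteq> frontier J} = {K, L}"
  using assms by (auto simp: between_def)

lemma between_unique:
  assumes "between M \<sigma> K L" "between M \<sigma> K1 L1"
  shows "K1 = K \<and> L1 = L \<or> K1 = L \<and> L1 = K"
  using between_cells(4)[OF assms(1)] between_cells(3,4)[OF assms(2)]
  by (auto simp: doubleton_eq_iff)

lemma face_dist_pos:
  assumes "\<sigma> \<in> internal_faces M"
  shows "0 < face_dist M \<sigma>"
proof -
  obtain K L where KL: "between M \<sigma> K L" using internal_face_obtain[OF assms] .
  have "face_dist M \<sigma> = dist (center M K) (center M L)"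
    unfolding face_dist_def
    using KL by (intro the_equality) (auto dest: between_unique[OF KL] simp: dist_commute)
  moreover have "center M L \<noteq> center M K"
    using fine KL unfolding admissible_mesh_def by blast
  ultimately show ?thesis by simp
qed

lemma face_measure_pos: "\<sigma> \<in> internal_faces M \<Longrightarrow> 0 < face_measure \<sigma>"
  using fine by (auto simp: admissible_mesh_def internal_faces_def)

lemma flux_abs_eq:
  assumes "F \<in> fluxes M" and "K \<in> cells M" and "\<sigma> \<in> internal_faces_of M K"
  shows "flux_abs M F \<sigma> = \<bar>F K \<sigma>\<bar>"
proof -
  have *: "\<sigma> \<in> internal_faces M" "\<sigma> \<subseteq> frontier K"
    using assms by (auto simp: internal_faces_of_def)
  obtain K1 L1 where KL: "between M \<sigma> K1 L1" using internal_face_obtain[OF *(1)] .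
  have sum0: "F K1 \<sigma> + F L1 \<sigma> = 0"
    using assms(1) KL by (auto simp: fluxes_def)
  have "flux_abs M F \<sigma> = \<bar>F K1 \<sigma>\<bar>"
    unfolding flux_abs_def
    using KL sum0 by (intro the_equality) (auto dest: between_unique[OF KL])
  moreover have "K = K1 \<or> K = L1"
    using between_cells(4)[OF KL] assms(2) * by auto
  ultimately show ?thesis using sum0 by auto
qed

text \<open>Every internal face contributes two opposite terms, hence no mass is created.\<close>

lemma sum_discrete_div:
  assumes "F \<in> fluxes M"
  shows "(\<Sum>K\<in>cells M. discrete_div M F K * cell_measure K) = 0"
proof -
  have "(\<Sum>K\<in>cells M. discrete_div M F K * cell_measure K) =
      (\<Sum>K\<in>cells M. \<Sum>\<sigma>\<in>internal_faces_of M K. F K \<sigma> * face_measure \<sigma>)"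
    by (intro sum.cong) (auto simp: discrete_div_def dest: fine_cell_measure_pos)
  also have "\<dots> = (\<Sum>K\<in>cells M. \<Sum>\<sigma> | \<sigma> \<in> internal_faces M \<and> \<sigma> \<subseteq> frontier K. F K \<sigma> * face_measure \<sigma>)"
    by (simp add: internal_faces_of_def)
  also have "\<dots> = (\<Sum>\<sigma>\<in>internal_faces M. \<Sum>K | K \<in> cells M \<and> \<sigma> \<subseteq> frontier K. F K \<sigma> * face_measure \<sigma>)"
    by (intro sum.swap_restrict) auto
  also have "\<dots> = 0"
  proof (rule sum.neutral, rule ballI)
    fix \<sigma> assume "\<sigma> \<in> internal_faces M"
    then obtain K L where KL: "between M \<sigma> K L" by (rule internal_face_obtain)
    have "F K \<sigma> + F L \<sigma> = 0"
      using assms KL by (auto simp: fluxes_def)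
    then show "(\<Sum>K | K \<in> cells M \<and> \<sigma> \<subseteq> frontier K. F K \<sigma> * face_measure \<sigma>) = 0"
      using between_cells(3,4)[OF KL] by (simp flip: distrib_right)
  qed
  finally show ?thesis .
qed

section \<open>The constraint set\<close>

lemma constraint_setD:
  assumes "(\<rho>, F) \<in> constraint_set N M' M \<rho>in \<rho>f"
  shows "(\<rho>, F) \<in> trajectories N M' M"
    and "\<And>k K. k \<in> {1..N+1} \<Longrightarrow> K \<in> cells M \<Longrightarrow>
           inject M' M (\<lambda>K'. (\<rho> k K' - \<rho> (k - 1) K') / time_step N) K + discrete_div M (F k) K = 0"
    and "\<rho> 0 = \<rho>in" and "\<rho> (N + 1) = \<rho>f"
  using assms by (auto simp: constraint_set_def)

lemma trajectory_zero:
  assumes "(\<rho>, F) \<in> trajectories N M' M"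
  shows "\<not> (k \<in> {0..N+1} \<and> K \<in> cells M') \<Longrightarrow> \<rho> k K = 0"
    and "\<not> (k \<in> {1..N+1} \<and> L \<in> cells M \<and> \<sigma> \<in> internal_faces_of M L) \<Longrightarrow> F k L \<sigma> = 0"
proof -
  show "\<rho> k K = 0" if "\<not> (k \<in> {0..N+1} \<and> K \<in> cells M')"
    using assms that by (cases "k \<in> {0..N+1}") (auto simp: trajectories_def vectors_def)
  show "F k L \<sigma> = 0" if "\<not> (k \<in> {1..N+1} \<and> L \<in> cells M \<and> \<sigma> \<in> internal_faces_of M L)"
  proof (cases "k \<in> {1..N+1}")
    case True
    then have "F k \<in> fluxes M" using assms by (simp add: trajectories_def)
    then show ?thesis using that True unfolding fluxes_def by blast
  next
    case False
    then show ?thesis using assms by (simp add: trajectories_def)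
  qed
qed

lemma constraint_set_antisymmetric:
  assumes "(\<rho>, F) \<in> constraint_set N M' M \<rho>in \<rho>f" and "k \<in> {1..N+1}" and "between M \<sigma> K L"
  shows "F k K \<sigma> + F k L \<sigma> = 0"
proof -
  have "F k \<in> fluxes M"
    using constraint_setD(1)[OF assms(1)] assms(2) by (simp add: trajectories_def)
  then show ?thesis using assms(3) by (simp add: fluxes_def)
qed

text \<open>The constraint set, spelled out as a family of affine equations in the components.\<close>

lemma constraint_set_iff:
  "(\<rho>, F) \<in> constraint_set N M' M \<rho>in \<rho>f \<longleftrightarrow>
     (\<forall>k K. \<not> (k \<in> {0..N+1} \<and> K \<in> cells M') \<longrightarrow> \<rho> k K = 0) \<and>
     (\<forall>k K \<sigma>. \<not> (k \<in> {1..N+1} \<and> K \<in> cells M \<and> \<sigma> \<in> internal_faces_of M K) \<longrightarrow> F k K \<sigma> = 0) \<and>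
     (\<forall>k\<in>{1..N+1}. \<forall>\<sigma> K L. between M \<sigma> K L \<longrightarrow> F k K \<sigma> + F k L \<sigma> = 0) \<and>
     (\<forall>k\<in>{1..N+1}. \<forall>K\<in>cells M.
        inject M' M (\<lambda>K'. (\<rho> k K' - \<rho> (k - 1) K') / time_step N) K + discrete_div M (F k) K = 0) \<and>
     (\<forall>K. \<rho> 0 K = \<rho>in K) \<and> (\<forall>K. \<rho> (N + 1) K = \<rho>f K)" (is "?L \<longleftrightarrow> ?R")
proof
  assume L: ?L
  show ?R
    using constraint_setD(2-4)[OF L] trajectory_zero[OF constraint_setD(1)[OF L]]
      constraint_set_antisymmetric[OF L]
    by (intro conjI allI ballI impI) simp_all
next
  assume R: ?R
  then have "\<rho> 0 = \<rho>in" "\<rho> (N + 1) = \<rho>f" by (simp_all add: fun_eq_iff)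
  moreover have "(\<rho>, F) \<in> trajectories N M' M"
    unfolding trajectories_def vectors_def fluxes_def mem_Collect_eq prod.case fun_eq_iff
    using R by (intro conjI allI ballI impI; blast)
  ultimately show ?L
    using R by (simp add: constraint_set_def)
qed

lemma constraint_set_convex:
  assumes "(\<rho>1, F1) \<in> constraint_set N M' M \<rho>in \<rho>f" "(\<rho>2, F2) \<in> constraint_set N M' M \<rho>in \<rho>f"
  shows "(\<lambda>k K. (1 - t) * \<rho>1 k K + t * \<rho>2 k K, \<lambda>k K \<sigma>. (1 - t) * F1 k K \<sigma> + t * F2 k K \<sigma>)
    \<in> constraint_set N M' M \<rho>in \<rho>f"
proof -
  have "((1 - t) * F1 k K \<sigma> + t * F2 k K \<sigma>) + ((1 - t) * F1 k L \<sigma> + t * F2 k L \<sigma>) = 0"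
    if "k \<in> {1..N+1}" "between M \<sigma> K L" for k \<sigma> K L
  proof -
    have "F1 k K \<sigma> + F1 k L \<sigma> = 0" "F2 k K \<sigma> + F2 k L \<sigma> = 0"
      using assms[THEN constraint_set_antisymmetric, OF that] .
    then have "F1 k L \<sigma> = - F1 k K \<sigma>" "F2 k L \<sigma> = - F2 k K \<sigma>" by linarith+
    then show ?thesis by simp
  qed
  moreover have "inject M' M (\<lambda>K'. (((1 - t) * \<rho>1 k K' + t * \<rho>2 k K')
        - ((1 - t) * \<rho>1 (k - 1) K' + t * \<rho>2 (k - 1) K')) / time_step N) K
      + discrete_div M (\<lambda>K \<sigma>. (1 - t) * F1 k K \<sigma> + t * F2 k K \<sigma>) K = 0"
    if k: "k \<in> {1..N+1}" and K: "K \<in> cells M" for k K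
  proof -
    obtain K' where K': "\<And>a. inject M' M a K = a K'" using inject_obtain[OF K] by blast
    have div: "discrete_div M (\<lambda>K \<sigma>. (1 - t) * F1 k K \<sigma> + t * F2 k K \<sigma>) K
        = (1 - t) * discrete_div M (F1 k) K + t * discrete_div M (F2 k) K"
      by (simp add: discrete_div_def sum_distrib_left sum.distrib algebra_simps add_divide_distrib
          diff_divide_distrib sum_subtractf)
    have eqs: "discrete_div M (F1 k) K = - ((\<rho>1 k K' - \<rho>1 (k - 1) K') / time_step N)"
      "discrete_div M (F2 k) K = - ((\<rho>2 k K' - \<rho>2 (k - 1) K') / time_step N)"
      using constraint_setD(2)[OF assms(1) k K] constraint_setD(2)[OF assms(2) k K]
      unfolding K' by linarith+
    show ?thesis unfolding div eqs K'
      by (simp add: divide_inverse algebra_simps)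
  qed
  moreover have "(1 - t) * \<rho>1 0 K + t * \<rho>2 0 K = \<rho>in K"
    "(1 - t) * \<rho>1 (N + 1) K + t * \<rho>2 (N + 1) K = \<rho>f K" for K
    using constraint_setD(3,4)[OF assms(1)] constraint_setD(3,4)[OF assms(2)]
    by (simp_all add: left_diff_distrib)
  moreover have "(1 - t) * \<rho>1 k K + t * \<rho>2 k K = 0" if "\<not> (k \<in> {0..N+1} \<and> K \<in> cells M')" for k K
    using trajectory_zero(1)[OF constraint_setD(1)[OF assms(1)] that]
      trajectory_zero(1)[OF constraint_setD(1)[OF assms(2)] that] by simp
  moreover have "(1 - t) * F1 k K \<sigma> + t * F2 k K \<sigma> = 0"
    if "\<not> (k \<in> {1..N+1} \<and> K \<in> cells M \<and> \<sigma> \<in> internal_faces_of M K)" for k K \<sigma>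
    using trajectory_zero(2)[OF constraint_setD(1)[OF assms(1)] that]
      trajectory_zero(2)[OF constraint_setD(1)[OF assms(2)] that] by simp
  ultimately show ?thesis
    unfolding constraint_set_iff by (intro conjI allI ballI impI) (assumption | blast)+
qed

lemma constraint_set_sequentially_closed:
  assumes mem: "\<And>n. (\<rho>s n, Fs n) \<in> constraint_set N M' M \<rho>in \<rho>f"
    and lim: "\<And>k K. (\<lambda>n. \<rho>s n k K) \<longlonglongrightarrow> \<rho> k K" "\<And>k K \<sigma>. (\<lambda>n. Fs n k K \<sigma>) \<longlonglongrightarrow> F k K \<sigma>"
  shows "(\<rho>, F) \<in> constraint_set N M' M \<rho>in \<rho>f"
proof -
  have const: "x = c" if "f \<longlonglongrightarrow> x" "\<And>n. f n = c" for f :: "nat \<Rightarrow> real" and x c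
  proof -
    have "f = (\<lambda>_. c)" using that(2) by (rule ext)
    then show ?thesis using that(1) by (simp add: LIMSEQ_const_iff)
  qed
  have "\<rho> k K = 0" if "\<not> (k \<in> {0..N+1} \<and> K \<in> cells M')" for k K
    using trajectory_zero(1)[OF constraint_setD(1)[OF mem] that] by (intro const[OF lim(1)])
  moreover have "F k K \<sigma> = 0" if "\<not> (k \<in> {1..N+1} \<and> K \<in> cells M \<and> \<sigma> \<in> internal_faces_of M K)" for k K \<sigma>
    using trajectory_zero(2)[OF constraint_setD(1)[OF mem] that] by (intro const[OF lim(2)])
  moreover have "F k K \<sigma> + F k L \<sigma> = 0" if "k \<in> {1..N+1}" "between M \<sigma> K L" for k \<sigma> K L
  proof (rule const[OF tendsto_add[OF lim(2) lim(2)]])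
    show "Fs n k K \<sigma> + Fs n k L \<sigma> = 0" for n
      using mem that by (rule constraint_set_antisymmetric)
  qed
  moreover have "inject M' M (\<lambda>K'. (\<rho> k K' - \<rho> (k - 1) K') / time_step N) K + discrete_div M (F k) K = 0"
    if k: "k \<in> {1..N+1}" and K: "K \<in> cells M" for k K
  proof -
    have "(\<lambda>n. inject M' M (\<lambda>K'. (\<rho>s n k K' - \<rho>s n (k - 1) K') / time_step N) K + discrete_div M (Fs n k) K)
        \<longlonglongrightarrow> inject M' M (\<lambda>K'. (\<rho> k K' - \<rho> (k - 1) K') / time_step N) K + discrete_div M (F k) K"
      unfolding inject_def discrete_div_def if_P[OF K]
      by (intro tendsto_intros lim) (auto simp: time_step_def)
    then show ?thesis by (rule const) (rule constraint_setD(2)[OF mem k K])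
  qed
  moreover have "\<rho> 0 K = \<rho>in K" "\<rho> (N + 1) K = \<rho>f K" for K
    using constraint_setD(3,4)[OF mem] by (intro const[OF lim(1)]; simp)+
  ultimately show ?thesis
    unfolding constraint_set_iff by (intro conjI allI ballI impI)
qed

section \<open>A priori bounds\<close>

text \<open>The mass is measured on the fine mesh: each coarse value is weighted with the total
  measure of the fine cells inside its coarse cell. That these weights are positive is all
  that is needed for the bounds below.\<close>

lemma mass_conservation:
  assumes C: "(\<rho>, F) \<in> constraint_set N M' M \<rho>in \<rho>f" and "k \<le> N + 1"
  shows "(\<Sum>K\<in>cells M. inject M' M (\<rho> k) K * cell_measure K)
    = (\<Sum>K\<in>cells M. inject M' M \<rho>in K * cell_measure K)"
  using \<open>k \<le> N + 1\<close>
proof (induction k)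
  case 0
  then show ?case using constraint_setD(3)[OF C] by simp
next
  case (Suc k)
  have F: "F (Suc k) \<in> fluxes M"
    using constraint_setD(1)[OF C] Suc.prems by (auto simp: trajectories_def)
  have step: "inject M' M (\<rho> (Suc k)) K - inject M' M (\<rho> k) K
      = - time_step N * discrete_div M (F (Suc k)) K" if K: "K \<in> cells M" for K
  proof -
    obtain K' where K': "\<And>a. inject M' M a K = a K'" using inject_obtain[OF K] by blast
    have "0 < time_step N" by (simp add: time_step_def)
    then show ?thesis
      using constraint_setD(2)[OF C _ K, of "Suc k"] Suc.prems by (simp add: K' field_simps)
  qed
  have "(\<Sum>K\<in>cells M. inject M' M (\<rho> (Suc k)) K * cell_measure K)
      - (\<Sum>K\<in>cells M. inject M' M (\<rho> k) K * cell_measure K)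
    = (\<Sum>K\<in>cells M. (inject M' M (\<rho> (Suc k)) K - inject M' M (\<rho> k) K) * cell_measure K)"
    by (simp add: sum_subtractf left_diff_distrib)
  also have "\<dots> = (\<Sum>K\<in>cells M. - time_step N * (discrete_div M (F (Suc k)) K * cell_measure K))"
    using step by (intro sum.cong) (simp_all add: mult.assoc)
  also have "\<dots> = 0"
    using sum_discrete_div[OF F] by (simp only: sum_distrib_left[symmetric])
  finally show ?case using Suc by simp
qed

text \<open>For nonnegative densities, the conserved mass bounds each component, uniformly over the
  constraint set.\<close>

lemma density_bound:
  obtains B where "1 \<le> B"
    "\<And>\<rho> F k K. (\<rho>, F) \<in> constraint_set N M' M \<rho>in \<rho>f \<Longrightarrow>
      (\<forall>k\<in>{0..N+1}. \<forall>K\<in>cells M'. 0 \<le> \<rho> k K) \<Longrightarrow> \<rho> k K \<le> B"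
proof -
  define W where "W = \<bar>\<Sum>K\<in>cells M. inject M' M \<rho>in K * cell_measure K\<bar>"
  define B where "B = 1 + (\<Sum>K\<in>cells M. W / cell_measure K)"
  have pos: "0 \<le> W / cell_measure K" if "K \<in> cells M" for K
    using fine_cell_measure_pos[OF that] by (simp add: W_def)
  then have "1 \<le> B" by (simp add: B_def sum_nonneg)
  moreover have "\<rho> k K' \<le> B" if C: "(\<rho>, F) \<in> constraint_set N M' M \<rho>in \<rho>f"
    and nonneg: "\<forall>k\<in>{0..N+1}. \<forall>K\<in>cells M'. 0 \<le> \<rho> k K" for \<rho> F k K'
  proof (cases "k \<in> {0..N+1} \<and> K' \<in> cells M'")
    case True
    obtain K where K: "K \<in> cells M" "\<And>a. inject M' M a K = a K'"
      using True coarse_cell_contains_fine_cell[of K'] by blast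
    have nn: "0 \<le> inject M' M (\<rho> k) L * cell_measure L" if L: "L \<in> cells M" for L
    proof -
      obtain L' where "L' \<in> cells M'" "\<And>a. inject M' M a L = a L'"
        using inject_obtain[OF L] by blast
      then show ?thesis
        using nonneg True fine_cell_measure_pos[OF L] by (simp add: less_imp_le)
    qed
    have "\<rho> k K' * cell_measure K \<le> (\<Sum>K\<in>cells M. inject M' M (\<rho> k) K * cell_measure K)"
      using K nn member_le_sum[of K "cells M" "\<lambda>K. inject M' M (\<rho> k) K * cell_measure K"] by auto
    also have "\<dots> \<le> W"
      using mass_conservation[OF C, of k] True by (simp add: W_def)
    finally have "\<rho> k K' \<le> W / cell_measure K"
      using fine_cell_measure_pos[OF K(1)] by (simp add: field_simps)
    also have "\<dots> \<le> (\<Sum>K\<in>cells M. W / cell_measure K)"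
      using K pos by (intro member_le_sum) auto
    finally show ?thesis by (simp add: B_def)
  next
    case False
    then have "\<rho> k K' = 0" using trajectory_zero(1)[OF constraint_setD(1)[OF C]] by blast
    then show ?thesis using \<open>1 \<le> B\<close> by simp
  qed
  ultimately show ?thesis using that by blast
qed

end

section \<open>Reconstruction and kinetic energy\<close>

text \<open>Concavity and homogeneity make the reconstruction superadditive; since it is also
  nonnegative, it is monotone, and it is therefore bounded on bounded sets.\<close>

lemma reconstruction_mono:
  assumes "reconstruction M R" and "\<sigma> \<in> internal_faces M"
    and "a \<in> vectors (cells M)" "b \<in> vectors (cells M)"
    and "\<And>K. K \<in> cells M \<Longrightarrow> 0 \<le> a K" "\<And>K. K \<in> cells M \<Longrightarrow> a K \<le> b K"
  shows "R a \<sigma> \<le> R b \<sigma>"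
proof -
  define nonneg where "nonneg = {a \<in> vectors (cells M). \<forall>K\<in>cells M. 0 \<le> a K}"
  define c where "c = (\<lambda>K. b K - a K)"
  have concave: "(1 - t) * R u \<sigma> + t * R v \<sigma> \<le> R (\<lambda>K. (1 - t) * u K + t * v K) \<sigma>"
    if "u \<in> nonneg" "v \<in> nonneg" "t \<in> {0..1}" for u v t
    using assms(1,2) that by (simp add: reconstruction_def Let_def nonneg_def)
  have homogeneous: "R (\<lambda>K. t * u K) \<sigma> = t * R u \<sigma>" if "u \<in> nonneg" "0 < t" for u t
    using assms(1,2) that by (simp add: reconstruction_def Let_def nonneg_def)
  have nonnegative: "0 \<le> R u \<sigma>" if "u \<in> nonneg" for u
    using assms(1,2) that by (simp add: reconstruction_def Let_def nonneg_def)
  have "0 \<le> b K" if "K \<in> cells M" for K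
    using assms(5,6)[OF that] by simp
  then have mem: "a \<in> nonneg" "b \<in> nonneg" "c \<in> nonneg"
    using assms(3-) by (simp_all add: nonneg_def c_def vectors_def)
  have "(\<lambda>K. (1 - 1/2) * a K + 1/2 * c K) = (\<lambda>K. 1/2 * b K)"
    by (simp add: c_def field_simps)
  then have "(1 - 1/2) * R a \<sigma> + 1/2 * R c \<sigma> \<le> 1/2 * R b \<sigma>"
    using concave[OF mem(1,3), of "1/2"] homogeneous[OF mem(2), of "1/2"] by simp
  then show ?thesis using nonnegative[OF mem(3)] by simp
qed

lemma kinetic_nonneg: "0 \<le> kinetic p Q"
  by (simp add: kinetic_def)

text \<open>If the density is bounded, a bound on the kinetic energy bounds the flux.\<close>

lemma kinetic_bound:
  assumes "ereal t * (kinetic p Q * ereal w) \<le> ereal C" and "0 < t" "0 < w"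
  shows "Q\<^sup>2 * (t * w) \<le> 2 * p * C"
proof -
  consider "0 < p" | "p = 0" "Q = 0" | "kinetic p Q = \<infinity>"
    unfolding kinetic_def by fastforce
  then show ?thesis
  proof cases
    case 1
    then have "t * (Q\<^sup>2 / (2 * p) * w) \<le> C"
      using assms by (simp add: kinetic_def)
    then show ?thesis using 1 by (simp add: field_simps)
  next
    case 2
    then show ?thesis by simp
  next
    case 3
    then show ?thesis using assms by simp
  qed
qed

context nested_meshes
begin

lemma time_step_pos: "0 < time_step N"
  by (simp add: time_step_def)

lemma face_weight_pos: "\<sigma> \<in> internal_faces M \<Longrightarrow> 0 < face_measure \<sigma> * face_dist M \<sigma>"
  using face_measure_pos face_dist_pos by simp

lemma action_term_nonneg:
  "\<sigma> \<in> internal_faces M \<Longrightarrow> 0 \<le> kinetic p Q * ereal (face_measure \<sigma> * face_dist M \<sigma>)"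
  using face_weight_pos kinetic_nonneg by (intro ereal_0_le_mult) (auto simp: less_imp_le)

lemma action_nonneg: "0 \<le> action N M' M R p"
proof -
  have "0 \<le> ereal (time_step N) * (\<Sum>\<sigma>\<in>internal_faces M. kinetic (f \<sigma>) (g \<sigma>)
      * ereal (face_measure \<sigma> * face_dist M \<sigma>))" for f g :: "'a set \<Rightarrow> real"
    by (rule ereal_0_le_mult) (auto intro!: sum_nonneg action_term_nonneg simp: less_imp_le[OF time_step_pos])
  then show ?thesis
    by (auto simp: action_def split: prod.split intro!: add_nonneg_nonneg sum_nonneg)
qed

lemma action_finite_nonneg:
  assumes "action N M' M R (\<rho>, F) \<noteq> \<infinity>"
  shows "\<forall>k\<in>{0..N+1}. \<forall>K\<in>cells M'. 0 \<le> \<rho> k K"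
proof (rule ccontr)
  assume neg: "\<not> ?thesis"
  show False using assms unfolding action_def prod.case if_not_P[OF neg] by simp
qed

lemma action_term_le:
  assumes "action N M' M R (\<rho>, F) \<noteq> \<infinity>" and k: "k \<in> {1..N+1}" and \<sigma>: "\<sigma> \<in> internal_faces M"
  shows "ereal (time_step N) * (kinetic (R (inject M' M (\<lambda>K. (\<rho> k K + \<rho> (k - 1) K) / 2)) \<sigma>)
      (flux_abs M (F k) \<sigma>) * ereal (face_measure \<sigma> * face_dist M \<sigma>)) \<le> action N M' M R (\<rho>, F)"
proof -
  define g where "g k \<sigma> = kinetic (R (inject M' M (\<lambda>K. (\<rho> k K + \<rho> (k - 1) K) / 2)) \<sigma>)
      (flux_abs M (F k) \<sigma>) * ereal (face_measure \<sigma> * face_dist M \<sigma>)" for k \<sigma>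
  have g: "0 \<le> g k \<sigma>" if "\<sigma> \<in> internal_faces M" for k \<sigma>
    unfolding g_def using that by (rule action_term_nonneg)
  have "g k \<sigma> \<le> (\<Sum>\<sigma>\<in>internal_faces M. g k \<sigma>)"
    using sum_mono2[of "internal_faces M" "{\<sigma>}" "g k"] \<sigma> g by simp
  then have "ereal (time_step N) * g k \<sigma> \<le> ereal (time_step N) * (\<Sum>\<sigma>\<in>internal_faces M. g k \<sigma>)"
    by (intro ereal_mult_left_mono) (simp_all add: less_imp_le[OF time_step_pos])
  also have "\<dots> \<le> (\<Sum>k=1..N+1. ereal (time_step N) * (\<Sum>\<sigma>\<in>internal_faces M. g k \<sigma>))"
  proof -
    have "0 \<le> ereal (time_step N) * (\<Sum>\<sigma>\<in>internal_faces M. g k \<sigma>)" for k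
      by (rule ereal_0_le_mult) (auto intro!: sum_nonneg g simp: less_imp_le[OF time_step_pos])
    then show ?thesis
      using sum_mono2[of "{1..N+1}" "{k}" "\<lambda>k. ereal (time_step N) * (\<Sum>\<sigma>\<in>internal_faces M. g k \<sigma>)"] k
      by simp
  qed
  also have "\<dots> = action N M' M R (\<rho>, F)"
    unfolding action_def prod.case if_P[OF action_finite_nonneg[OF assms(1)]] g_def ..
  finally show ?thesis unfolding g_def .
qed

text \<open>On a sublevel set of the action the densities are bounded, hence so are their
  reconstructions by monotonicity, hence so are the fluxes.\<close>

lemma flux_bound:
  assumes R: "reconstruction M R" and k: "k \<in> {1..N+1}" and K: "K \<in> cells M"
    and \<sigma>: "\<sigma> \<in> internal_faces_of M K"
  shows "\<exists>Q. \<forall>\<rho> F. (\<rho>, F) \<in> constraint_set N M' M \<rho>in \<rho>f \<longrightarrow> action N M' M R (\<rho>, F) \<le> ereal A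
    \<longrightarrow> \<bar>F k K \<sigma>\<bar> \<le> Q"
proof -
  obtain B where B: "1 \<le> B" "\<And>\<rho> F k K. (\<rho>, F) \<in> constraint_set N M' M \<rho>in \<rho>f \<Longrightarrow>
      (\<forall>k\<in>{0..N+1}. \<forall>K\<in>cells M'. 0 \<le> \<rho> k K) \<Longrightarrow> \<rho> k K \<le> B"
    using density_bound by blast
  define b where "b = (\<lambda>K. if K \<in> cells M then B else 0)"
  define w where "w = time_step N * (face_measure \<sigma> * face_dist M \<sigma>)"
  have \<sigma>': "\<sigma> \<in> internal_faces M" using \<sigma> by (simp add: internal_faces_of_def)
  have w: "0 < w" using time_step_pos face_weight_pos[OF \<sigma>'] by (simp add: w_def)
  have "\<bar>F k K \<sigma>\<bar> \<le> sqrt (2 * R b \<sigma> * A / w)"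
    if C: "(\<rho>, F) \<in> constraint_set N M' M \<rho>in \<rho>f" and A: "action N M' M R (\<rho>, F) \<le> ereal A" for \<rho> F
  proof -
    define a where "a = inject M' M (\<lambda>K. (\<rho> k K + \<rho> (k - 1) K) / 2)"
    have fin: "action N M' M R (\<rho>, F) \<noteq> \<infinity>" using A by auto
    note nonneg = action_finite_nonneg[OF fin]
    have F: "F k \<in> fluxes M"
      using constraint_setD(1)[OF C] k by (auto simp: trajectories_def)
    have "ereal 0 \<le> ereal A"
      using order_trans[OF action_nonneg A] by (simp add: zero_ereal_def)
    then have "0 \<le> A" by simp
    have a: "0 \<le> a L" "a L \<le> b L" if L: "L \<in> cells M" for L
    proof -
      obtain L' where L': "L' \<in> cells M'" "\<And>a. inject M' M a L = a L'"
        using inject_obtain[OF L] by blast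
      have "0 \<le> \<rho> k L'" "0 \<le> \<rho> (k - 1) L'" using nonneg L' k by auto
      then show "0 \<le> a L" by (simp add: a_def L')
      show "a L \<le> b L"
        using B(2)[OF C nonneg, of k L'] B(2)[OF C nonneg, of "k - 1" L'] L by (simp add: a_def b_def L')
    qed
    have "ereal (time_step N) * (kinetic (R a \<sigma>) (flux_abs M (F k) \<sigma>)
        * ereal (face_measure \<sigma> * face_dist M \<sigma>)) \<le> ereal A"
      using order_trans[OF action_term_le[OF fin k \<sigma>'] A] by (simp only: a_def)
    then have "(flux_abs M (F k) \<sigma>)\<^sup>2 * w \<le> 2 * R a \<sigma> * A"
      unfolding w_def using time_step_pos face_weight_pos[OF \<sigma>'] by (rule kinetic_bound)
    also have "\<dots> \<le> 2 * R b \<sigma> * A"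
    proof -
      have "R a \<sigma> \<le> R b \<sigma>"
        using inject_vectors a by (intro reconstruction_mono[OF R \<sigma>']) (auto simp: a_def b_def vectors_def inject_def)
      then show ?thesis using \<open>0 \<le> A\<close> by (simp add: mult_right_mono)
    qed
    finally have "(F k K \<sigma>)\<^sup>2 \<le> 2 * R b \<sigma> * A / w"
      using w flux_abs_eq[OF F K \<sigma>] by (simp add: field_simps)
    then show ?thesis by (intro real_le_rsqrt) simp
  qed
  then show ?thesis by blast
qed

section \<open>The logarithmic barrier\<close>

lemma barrier_finite:
  assumes "\<forall>k\<in>{1..N}. \<forall>K\<in>cells M'. 0 < \<rho> k K"
  shows "\<exists>b. barrier N M' \<rho> = ereal b"
proof -
  have "barrier N M' \<rho> = (\<Sum>k=1..N. ereal (time_step N * (\<Sum>K\<in>cells M'. - ln (\<rho> k K) * cell_measure K)))"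
    unfolding barrier_def
  proof (rule sum.cong)
    fix k assume "k \<in> {1..N}"
    then have "(\<Sum>K\<in>cells M'. log_barrier (\<rho> k K) * ereal (cell_measure K))
        = (\<Sum>K\<in>cells M'. ereal (- ln (\<rho> k K) * cell_measure K))"
      using assms by (intro sum.cong) (simp_all add: log_barrier_def)
    then show "ereal (time_step N) * (\<Sum>K\<in>cells M'. log_barrier (\<rho> k K) * ereal (cell_measure K))
        = ereal (time_step N * (\<Sum>K\<in>cells M'. - ln (\<rho> k K) * cell_measure K))"
      by simp
  qed simp
  then show ?thesis by simp
qed

lemma barrier_finite_positive:
  assumes "barrier N M' \<rho> \<noteq> \<infinity>" "k \<in> {1..N}" "K \<in> cells M'"
  shows "0 < \<rho> k K"
proof (rule ccontr)
  assume "\<not> 0 < \<rho> k K"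
  then have "log_barrier (\<rho> k K) * ereal (cell_measure K) = \<infinity>"
    using coarse_cell_measure_pos[OF assms(3)] by (simp add: log_barrier_def)
  then have "(\<Sum>K\<in>cells M'. log_barrier (\<rho> k K) * ereal (cell_measure K)) = \<infinity>"
    using assms(3) finite_meshes(1) by (subst sum_Pinfty) blast
  then have "ereal (time_step N) * (\<Sum>K\<in>cells M'. log_barrier (\<rho> k K) * ereal (cell_measure K)) = \<infinity>"
    using time_step_pos[of N] by simp
  then have "barrier N M' \<rho> = \<infinity>"
    unfolding barrier_def using assms(2) by (subst sum_Pinfty) blast
  then show False using assms(1) by simp
qed

text \<open>The barrier tends to \<open>-\<infinity>\<close> only along unbounded densities.\<close>

lemma barrier_lower_bound:
  assumes "0 < B"
  shows "\<exists>c. \<forall>\<rho>. (\<forall>k K. \<rho> k K \<le> B) \<longrightarrow> ereal c \<le> barrier N M' \<rho>"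
proof -
  have "ereal (\<Sum>k=1..N. time_step N * (\<Sum>K\<in>cells M'. - ln B * cell_measure K)) \<le> barrier N M' \<rho>"
    if "\<forall>k K. \<rho> k K \<le> B" for \<rho>
  proof -
    have "ereal (- ln B * cell_measure K) \<le> log_barrier (\<rho> k K) * ereal (cell_measure K)"
      if K: "K \<in> cells M'" for k K
    proof -
      have "ereal (- ln B) \<le> log_barrier (\<rho> k K)"
        using \<open>\<forall>k K. \<rho> k K \<le> B\<close> assms by (simp add: log_barrier_def)
      then have "ereal (- ln B) * ereal (cell_measure K) \<le> log_barrier (\<rho> k K) * ereal (cell_measure K)"
        using coarse_cell_measure_pos[OF K] by (intro ereal_mult_right_mono) (auto simp: less_imp_le)
      then show ?thesis by simp
    qed
    then have "(\<Sum>K\<in>cells M'. ereal (- ln B * cell_measure K))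
        \<le> (\<Sum>K\<in>cells M'. log_barrier (\<rho> k K) * ereal (cell_measure K))" for k
      by (intro sum_mono)
    then have "(\<Sum>k=1..N. ereal (time_step N) * (\<Sum>K\<in>cells M'. ereal (- ln B * cell_measure K)))
        \<le> barrier N M' \<rho>"
      unfolding barrier_def
      by (intro sum_mono[of "{1..N}"] ereal_mult_left_mono) (simp_all only: ereal_less_eq(5) less_imp_le[OF time_step_pos])
    then show ?thesis by simp
  qed
  then show ?thesis by blast
qed

end

section \<open>Convergence of the minimizers\<close>

lemma lower_semicontinuous_on_sequentially:
  assumes "lower_semicontinuous_on S f" and "x \<longlonglongrightarrow> p" "p \<in> S" "\<And>n. x n \<in> S" and "c < f p"
  shows "\<forall>\<^sub>F n in sequentially. c < f (x n)"
proof -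
  have "\<forall>\<^sub>F y in at p within S. c < f y"
    using assms by (simp add: lower_semicontinuous_on_def)
  then obtain U where U: "open U" "p \<in> U" "\<And>y. y \<in> U \<Longrightarrow> y \<noteq> p \<Longrightarrow> y \<in> S \<Longrightarrow> c < f y"
    by (auto simp: eventually_at_topological)
  have "\<forall>\<^sub>F n in sequentially. x n \<in> U"
    using topological_tendstoD[OF assms(2) U(1,2)] .
  then show ?thesis
    by (rule eventually_mono) (use U(3) assms(4,5) in metis)
qed

context nested_meshes
begin

text \<open>Optimality in the perturbed problem, compared with a competitor of finite perturbed energy.\<close>

lemma perturbed_minimizer_action_le:
  assumes min: "is_arg_min (perturbed_action N M' M R m) (\<lambda>p. p \<in> C) (\<rho>, F)" and "0 < m"
    and y: "(\<rho>', F') \<in> C" "action N M' M R (\<rho>', F') = ereal a" "barrier N M' \<rho>' = ereal b"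
    and lower: "ereal c \<le> barrier N M' \<rho>"
  shows "action N M' M R (\<rho>, F) \<le> ereal (a + m * (b - c))"
proof -
  have le: "action N M' M R (\<rho>, F) + ereal m * barrier N M' \<rho> \<le> ereal (a + m * b)"
  proof -
    have "perturbed_action N M' M R m (\<rho>, F) \<le> perturbed_action N M' M R m (\<rho>', F')"
      using min y(1) by (simp add: is_arg_min_def not_less)
    then show ?thesis using y(2,3) by (simp add: perturbed_action_def)
  qed
  have "ereal (m * c) \<le> ereal m * barrier N M' \<rho>"
    using ereal_mult_left_mono[OF lower, of "ereal m"] \<open>0 < m\<close> by simp
  then have "action N M' M R (\<rho>, F) + ereal (m * c) \<le> ereal (a + m * b)"
    using le by (meson add_left_mono order_trans)
  then show ?thesis
    by (cases "action N M' M R (\<rho>, F)") (simp_all add: right_diff_distrib)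
qed

lemma constraint_set_bounded_action_convergent_subsequence:
  fixes s :: "nat \<Rightarrow> 'a trajectory"
  assumes R: "reconstruction M R" and C: "\<And>n. s n \<in> constraint_set N M' M \<rho>in \<rho>f"
    and A: "\<And>n. action N M' M R (s n) \<le> ereal A"
  obtains r p where "strict_mono (r :: nat \<Rightarrow> nat)" "(\<lambda>n. s (r n)) \<longlonglongrightarrow> p"
    "p \<in> constraint_set N M' M \<rho>in \<rho>f"
proof -
  define \<rho> where "\<rho> n = fst (s n)" for n
  define F where "F n = snd (s n)" for n
  have s: "s n = (\<rho> n, F n)" for n by (simp add: \<rho>_def F_def)
  note C = C[unfolded s] and A = A[unfolded s]
  obtain B where B: "1 \<le> B" "\<And>\<rho> F k K. (\<rho>, F) \<in> constraint_set N M' M \<rho>in \<rho>f \<Longrightarrow>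
      (\<forall>k\<in>{0..N+1}. \<forall>K\<in>cells M'. 0 \<le> \<rho> k K) \<Longrightarrow> \<rho> k K \<le> B"
    using density_bound by blast
  have nonneg: "\<forall>k\<in>{0..N+1}. \<forall>K\<in>cells M'. 0 \<le> \<rho> n k K" for n
  proof (rule action_finite_nonneg)
    show "action N M' M R (\<rho> n, F n) \<noteq> \<infinity>" using A[of n] by auto
  qed
  obtain r1 l1 where r1: "strict_mono (r1 :: nat \<Rightarrow> nat)"
    "\<And>i. (\<lambda>n. case i of (k, K) \<Rightarrow> \<rho> (r1 n) k K) \<longlonglongrightarrow> l1 i"
  proof (rule finite_support_convergent_subsequence)
    show "finite ({0..N+1} \<times> cells M')" by simp
    show "\<exists>B. \<forall>n. \<bar>case i of (k, K) \<Rightarrow> \<rho> n k K\<bar> \<le> B" if i: "i \<in> {0..N+1} \<times> cells M'" for i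
      using i nonneg B(2)[OF C nonneg] by (intro exI[of _ B]) auto
    show "(case i of (k, K) \<Rightarrow> \<rho> n k K) = 0" if "i \<notin> {0..N+1} \<times> cells M'" for n i
      using that trajectory_zero(1)[OF constraint_setD(1)[OF C]] by (cases i) auto
  qed (rule that)
  obtain r2 l2 where r2: "strict_mono (r2 :: nat \<Rightarrow> nat)"
    "\<And>i. (\<lambda>n. case i of (k, K, \<sigma>) \<Rightarrow> F (r1 (r2 n)) k K \<sigma>) \<longlonglongrightarrow> l2 i"
  proof (rule finite_support_convergent_subsequence)
    let ?I = "{1..N+1} \<times> (SIGMA K:cells M. internal_faces_of M K)"
    show "finite ?I" by (auto simp: internal_faces_of_def)
    show "\<exists>Q. \<forall>n. \<bar>case i of (k, K, \<sigma>) \<Rightarrow> F (r1 n) k K \<sigma>\<bar> \<le> Q" if i: "i \<in> ?I" for i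
    proof -
      obtain k K \<sigma> where k: "i = (k, K, \<sigma>)" "k \<in> {1..N+1}" "K \<in> cells M" "\<sigma> \<in> internal_faces_of M K"
        using i by auto
      show ?thesis using flux_bound[OF R k(2-4), of \<rho>in \<rho>f A] C A unfolding k(1) prod.case by blast
    qed
    show "(case i of (k, K, \<sigma>) \<Rightarrow> F (r1 n) k K \<sigma>) = 0" if "i \<notin> ?I" for n i
      using that trajectory_zero(2)[OF constraint_setD(1)[OF C]] by (cases i) auto
  qed (rule that)
  define p where "p = (\<lambda>k K. l1 (k, K), \<lambda>k K \<sigma>. l2 (k, K, \<sigma>))"
  have lim\<rho>: "(\<lambda>n. \<rho> (r1 (r2 n)) k K) \<longlonglongrightarrow> l1 (k, K)" for k K
    using LIMSEQ_subseq_LIMSEQ[OF r1(2)[of "(k, K)"] r2(1)] by (simp add: o_def)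
  have limF: "(\<lambda>n. F (r1 (r2 n)) k K \<sigma>) \<longlonglongrightarrow> l2 (k, K, \<sigma>)" for k K \<sigma>
    using r2(2)[of "(k, K, \<sigma>)"] by simp
  show thesis
  proof (rule that)
    show "strict_mono (\<lambda>n. r1 (r2 n))"
      using strict_mono_o[OF r1(1) r2(1)] by (simp add: o_def)
    show "(\<lambda>n. s (r1 (r2 n))) \<longlonglongrightarrow> p"
      unfolding s p_def by (intro tendsto_Pair) (simp_all add: tendsto_fun_iff lim\<rho> limF)
    show "p \<in> constraint_set N M' M \<rho>in \<rho>f"
      unfolding p_def by (rule constraint_set_sequentially_closed[OF C lim\<rho> limF])
  qed
qed

text \<open>A competitor \<open>y\<close> of smaller action than the limit may touch the boundary of the positive
  cone, where the barrier is infinite. It is therefore moved slightly towards a point \<open>q\<close> with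
  finite barrier; by convexity this costs arbitrarily little action, and it makes the barrier
  finite, so that its contribution vanishes as \<open>\<mu>\<close> tends to \<open>0\<close>.\<close>

lemma perturbed_minimizers_limit_minimal:
  fixes s :: "nat \<Rightarrow> 'a trajectory"
  assumes C_def: "C = constraint_set N M' M \<rho>in \<rho>f"
    and convex: "convex_functional_on (trajectories N M' M) (action N M' M R)"
    and lsc: "lower_semicontinuous_on (trajectories N M' M) (action N M' M R)"
    and \<mu>: "\<And>n. 0 < \<mu> n" "\<mu> \<longlonglongrightarrow> 0"
    and min: "\<And>n. is_arg_min (perturbed_action N M' M R (\<mu> n)) (\<lambda>p. p \<in> C) (s n)"
    and lower: "\<And>n. ereal c \<le> barrier N M' (fst (s n))"
    and p: "s \<longlonglongrightarrow> p" "p \<in> C"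
    and q: "(\<rho>q, Fq) \<in> C" "action N M' M R (\<rho>q, Fq) = ereal aq" "barrier N M' \<rho>q \<noteq> \<infinity>"
  shows "is_arg_min (action N M' M R) (\<lambda>p. p \<in> C) p"
  unfolding is_arg_min_def
proof (intro conjI notI)
  show "p \<in> C" by fact
  have traj: "x \<in> trajectories N M' M" if "x \<in> C" for x
    using that by (auto simp: C_def constraint_set_def)
  assume "\<exists>y. y \<in> C \<and> action N M' M R y < action N M' M R p"
  then obtain \<rho>y Fy where y: "(\<rho>y, Fy) \<in> C" "action N M' M R (\<rho>y, Fy) < action N M' M R p"
    by auto
  then have "\<bar>action N M' M R (\<rho>y, Fy)\<bar> \<noteq> \<infinity>"
    using action_nonneg[of N R "(\<rho>y, Fy)"] by auto
  then obtain ay where ay: "action N M' M R (\<rho>y, Fy) = ereal ay" by auto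
  obtain d where d: "ay < d" "ereal d < action N M' M R p"
    using ereal_dense2[OF y(2)] ay by auto
  \<comment> \<open>a convex combination with the interior point \<open>q\<close>, close enough to \<open>y\<close> to keep the
    action below \<open>d\<close>\<close>
  define D where "D = \<bar>aq - ay\<bar> + 1"
  define t where "t = min 1 ((d - ay) / (2 * D))"
  have "0 < D" by (simp add: D_def)
  then have t: "0 < t" "t \<le> 1" "t * D \<le> (d - ay) / 2"
    using d(1) by (auto simp: t_def min_def field_simps)
  define \<rho>z where "\<rho>z = (\<lambda>k K. (1 - t) * \<rho>y k K + t * \<rho>q k K)"
  define Fz where "Fz = (\<lambda>k K \<sigma>. (1 - t) * Fy k K \<sigma> + t * Fq k K \<sigma>)"
  have z: "(\<rho>z, Fz) \<in> C"
    using constraint_set_convex y(1) q(1) unfolding C_def \<rho>z_def Fz_def by blast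
  have "action N M' M R (\<rho>z, Fz) \<le> ereal ((1 - t) * ay + t * aq)"
    using convex traj[OF y(1)] traj[OF q(1)] t ay q(2)
    unfolding convex_functional_on_def \<rho>z_def Fz_def by fastforce
  moreover have "(1 - t) * ay + t * aq < d"
  proof -
    have "t * (aq - ay) \<le> t * D" using t by (intro mult_left_mono) (auto simp: D_def)
    then show ?thesis using t(3) d(1) by (simp add: algebra_simps)
  qed
  ultimately have z_less: "action N M' M R (\<rho>z, Fz) < ereal d"
    by (meson ereal_less(2) less_ereal.simps(1) order_le_less_trans)
  then have "\<bar>action N M' M R (\<rho>z, Fz)\<bar> \<noteq> \<infinity>"
    using action_nonneg[of N R "(\<rho>z, Fz)"] by auto
  then obtain az where az: "action N M' M R (\<rho>z, Fz) = ereal az" by auto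
  have "0 < \<rho>z k K" if k: "k \<in> {1..N}" and K: "K \<in> cells M'" for k K
  proof -
    have "0 < \<rho>q k K" using barrier_finite_positive[OF q(3) k K] .
    moreover have "0 \<le> \<rho>y k K"
      using action_finite_nonneg[of N R \<rho>y Fy] ay k K by auto
    ultimately show ?thesis using t unfolding \<rho>z_def by (intro add_nonneg_pos) auto
  qed
  then obtain b where b: "barrier N M' \<rho>z = ereal b" using barrier_finite by blast
  have upper: "action N M' M R (s n) \<le> ereal (az + \<mu> n * (b - c))" for n
    using perturbed_minimizer_action_le[of N R "\<mu> n" C "fst (s n)" "snd (s n)", OF _ \<mu>(1) z az b lower]
      min by simp
  have "(\<lambda>n. az + \<mu> n * (b - c)) \<longlonglongrightarrow> az + 0 * (b - c)"
    by (intro tendsto_intros \<mu>(2))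
  moreover have "az + 0 * (b - c) < d" using z_less az by simp
  ultimately have "\<forall>\<^sub>F n in sequentially. az + \<mu> n * (b - c) < d"
    by (rule order_tendstoD)
  moreover have "\<forall>\<^sub>F n in sequentially. ereal d < action N M' M R (s n)"
    using lower_semicontinuous_on_sequentially[OF lsc p(1) traj[OF p(2)] traj d(2)] min
    by (simp add: is_arg_min_def)
  ultimately have "\<forall>\<^sub>F n in sequentially. False"
  proof eventually_elim
    case (elim n)
    have "ereal d < ereal (az + \<mu> n * (b - c))"
      using elim(2) upper[of n] by (rule less_le_trans)
    then show False using elim(1) by simp
  qed
  then show False by simp
qed

end

theorem theorem4p1:
  fixes \<Omega> :: "'a::euclidean_space set"
    and M' M :: "'a mesh"
    and R :: "('a set \<Rightarrow> real) \<Rightarrow> 'a set \<Rightarrow> real"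
    and N :: nat
    and \<rho>in \<rho>f :: "'a set \<Rightarrow> real"
    and sol :: "real \<Rightarrow> 'a trajectory"
    and \<mu> :: "nat \<Rightarrow> real"
  assumes "DIM('a) = 2 \<or> DIM('a) = 3"
    and "convex \<Omega>" and "compact \<Omega>" and "polytope \<Omega>"
    and "admissible_mesh \<Omega> M'" and "admissible_mesh \<Omega> M" and "mesh_refines M' M"
    and "reconstruction M R"
    and "convex_functional_on (trajectories N M' M) (action N M' M R)"
    and "lower_semicontinuous_on (trajectories N M' M) (action N M' M R)"
    and "N \<ge> 1"
    and "\<rho>in \<in> vectors (cells M')" and "\<forall>K\<in>cells M'. 0 \<le> \<rho>in K"
    and "\<rho>f \<in> vectors (cells M')" and "\<forall>K\<in>cells M'. 0 \<le> \<rho>f K"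
    and "total_mass M' \<rho>in = total_mass M' \<rho>f" and "0 < total_mass M' \<rho>in"
    and unique_solution: "\<And>m. 0 < m \<Longrightarrow>
      \<exists>!p. is_arg_min (perturbed_action N M' M R m) (\<lambda>p. p \<in> constraint_set N M' M \<rho>in \<rho>f) p"
    and solution: "\<And>m. 0 < m \<Longrightarrow>
      is_arg_min (perturbed_action N M' M R m) (\<lambda>p. p \<in> constraint_set N M' M \<rho>in \<rho>f) (sol m)"
    and "\<And>n. 0 < \<mu> n" and "\<mu> \<longlonglongrightarrow> 0"
  shows "\<exists>r p. strict_mono (r :: nat \<Rightarrow> nat) \<and>
      (\<lambda>n. sol (\<mu> (r n))) \<longlonglongrightarrow> p \<and>
      is_arg_min (action N M' M R) (\<lambda>p. p \<in> constraint_set N M' M \<rho>in \<rho>f) p"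
proof -
  interpret nested_meshes \<Omega> M' M
    using assms(5-7) by unfold_locales
  note R = assms(8) and convex = assms(9) and lsc = assms(10) and \<mu>_pos = assms(20) and \<mu>_lim = assms(21)
  define C where "C = constraint_set N M' M \<rho>in \<rho>f"
  have solC: "sol m \<in> C" if "0 < m" for m
    using solution[OF that] by (simp add: is_arg_min_def C_def)
  have sol_le: "perturbed_action N M' M R m (sol m) \<le> perturbed_action N M' M R m y" if "0 < m" "y \<in> C" for m y
    using solution[OF that(1)] that(2) by (cases y) (simp add: is_arg_min_def C_def not_less)
  obtain \<rho>q Fq where q: "sol 1 = (\<rho>q, Fq)" by fastforce
  have qC: "(\<rho>q, Fq) \<in> C" using solC[of 1] q by simp
  show ?thesis
  proof (cases "perturbed_action N M' M R 1 (\<rho>q, Fq) = \<infinity>")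
    case True
    \<comment> \<open>every element of \<open>C\<close> is then a minimizer, so by uniqueness \<open>C\<close> is a singleton\<close>
    have "is_arg_min (perturbed_action N M' M R 1) (\<lambda>p. p \<in> constraint_set N M' M \<rho>in \<rho>f) y" if "y \<in> C" for y
    proof -
      have "perturbed_action N M' M R 1 z = \<infinity>" if "z \<in> C" for z
        using sol_le[of 1 z] that True q by simp
      then show ?thesis using that by (auto simp: is_arg_min_def C_def)
    qed
    then have single: "y = (\<rho>q, Fq)" if "y \<in> C" for y
      using unique_solution[of 1] that qC zero_less_one by blast
    then have "sol (\<mu> n) = (\<rho>q, Fq)" for n
      using solC \<mu>_pos by blast
    then have "(\<lambda>n. sol (\<mu> (id n))) \<longlonglongrightarrow> (\<rho>q, Fq)" by simp
    moreover have "is_arg_min (action N M' M R) (\<lambda>p. p \<in> constraint_set N M' M \<rho>in \<rho>f) (\<rho>q, Fq)"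
      unfolding is_arg_min_def C_def[symmetric] using qC single by force
    ultimately show ?thesis using strict_mono_id by blast
  next
    case False
    then have fin: "action N M' M R (\<rho>q, Fq) \<noteq> \<infinity>" "barrier N M' \<rho>q \<noteq> \<infinity>"
      by (auto simp: perturbed_action_def one_ereal_def[symmetric])
    then have "\<bar>action N M' M R (\<rho>q, Fq)\<bar> \<noteq> \<infinity>"
      using action_nonneg[of N R "(\<rho>q, Fq)"] by auto
    then obtain aq where aq: "action N M' M R (\<rho>q, Fq) = ereal aq" by auto
    obtain bq where bq: "barrier N M' \<rho>q = ereal bq"
      using barrier_finite[of N \<rho>q] barrier_finite_positive[OF fin(2)] by blast
    obtain B where B: "1 \<le> B" "\<And>\<rho> F k K. (\<rho>, F) \<in> C \<Longrightarrow>
        (\<forall>k\<in>{0..N+1}. \<forall>K\<in>cells M'. 0 \<le> \<rho> k K) \<Longrightarrow> \<rho> k K \<le> B"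
      unfolding C_def using density_bound by blast
    obtain c where c: "\<And>\<rho>. (\<forall>k K. \<rho> k K \<le> B) \<Longrightarrow> ereal c \<le> barrier N M' \<rho>"
      using barrier_lower_bound[of B N] B(1) by auto
    have lower: "ereal c \<le> barrier N M' (fst (sol m))" if m: "0 < m" for m
    proof -
      obtain \<rho> F where s: "sol m = (\<rho>, F)" by fastforce
      have "perturbed_action N M' M R m (\<rho>, F) \<le> ereal (aq + m * bq)"
        using sol_le[OF m qC] s aq bq by (simp add: perturbed_action_def)
      then have "action N M' M R (\<rho>, F) \<noteq> \<infinity>"
        by (auto simp: perturbed_action_def)
      then have "\<rho> k K \<le> B" for k K
        using B(2)[of \<rho> F] action_finite_nonneg solC[OF m] s by metis
      then show ?thesis using c s by simp
    qed
    have upper: "action N M' M R (sol m) \<le> ereal (aq + m * (bq - c))" if m: "0 < m" for m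
      using perturbed_minimizer_action_le[of N R m C "fst (sol m)" "snd (sol m)", OF _ m qC aq bq lower[OF m]]
        solution[OF m] by (simp add: C_def)
    have "(\<lambda>n. aq + \<mu> n * (bq - c)) \<longlonglongrightarrow> aq + 0 * (bq - c)"
      using \<mu>_lim by (intro tendsto_intros)
    then have "Bseq (\<lambda>n. aq + \<mu> n * (bq - c))"
      by (intro convergent_imp_Bseq convergentI)
    then obtain A where A: "\<And>n. \<bar>aq + \<mu> n * (bq - c)\<bar> \<le> A"
      by (auto simp: Bseq_def)
    have "action N M' M R (sol (\<mu> n)) \<le> ereal A" for n
    proof -
      have "aq + \<mu> n * (bq - c) \<le> A" using A[of n] by simp
      then show ?thesis using upper[OF \<mu>_pos[of n]] by (meson ereal_less_eq(3) order_trans)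
    qed
    then obtain r p where r: "strict_mono (r :: nat \<Rightarrow> nat)"
      and p: "(\<lambda>n. sol (\<mu> (r n))) \<longlonglongrightarrow> p" "p \<in> C"
      using constraint_set_bounded_action_convergent_subsequence[OF R, of "\<lambda>n. sol (\<mu> n)" N \<rho>in \<rho>f A]
        solC[OF \<mu>_pos] unfolding C_def by blast
    have "(\<lambda>n. \<mu> (r n)) \<longlonglongrightarrow> 0"
      using LIMSEQ_subseq_LIMSEQ[OF \<mu>_lim r] by (simp add: o_def)
    then have "is_arg_min (action N M' M R) (\<lambda>p. p \<in> constraint_set N M' M \<rho>in \<rho>f) p"
      using perturbed_minimizers_limit_minimal[OF C_def convex lsc, of "\<lambda>n. \<mu> (r n)" "\<lambda>n. sol (\<mu> (r n))" c p \<rho>q Fq aq]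
        \<mu>_pos solution lower p qC aq fin(2) by (simp add: C_def)
    then show ?thesis using r p(1) by blast
  qed
qed

end
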